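(* Let $m$ be a positive integer. For all sufficiently large $n$ (that is, there is an integer $N$, possibly depending on $m$, such that for all integers $n\ge N$), $$\left\{\left(\sum_{k=0}^{\infty}\frac{1}{T_{n+mk}}\right)^{-1}\right\}=T_n-T_{n-m}.$$
   Context: $(T_n)$ is the Tribonacci sequence: $T_0=0$, $T_1=T_2=1$, and $T_n=T_{n-1}+T_{n-2}+T_{n-3}$. For a real number $j$, $\{j\}$ denotes the closest integer to $j$ (not the fractional part). *)

theory Defs
  imports Complex_Main
begin

fun tribonacci :: "nat \<Rightarrow> nat" where
  "tribonacci 0 = 0"
| "tribonacci (Suc 0) = 1"
| "tribonacci (Suc (Suc 0)) = 1"
| "tribonacci (Suc (Suc (Suc n))) =
     tribonacci (Suc (Suc n)) + tribonacci (Suc n) + tribonacci n"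

end

theory Submission
  imports Defs
begin

text \<open>
  Let \<open>a\<close> be the real root of \<open>x^3 = x^2 + x + 1\<close>. The defect \<open>u n = T (n+1) - a * T n\<close> satisfies a
  binary recurrence whose characteristic roots have modulus less than 1, so \<open>T (n+m) - a^m * T n\<close>
  tends to 0 and hence \<open>T n * T (n+2*m) - T (n+m)^2\<close> is \<open>o(T (n+m))\<close>. With \<open>D n = T n - T (n-m)\<close>,
  \<open>T n * (D (n+m) - D n) - D n * D (n+m) = T (n-m) * T (n+m) - T n^2\<close>, so for \<open>s = 1/4\<close> and large \<open>n\<close>
  \[1/(D n + s) - 1/(D (n+m) + s) \le 1/T n \le 1/(D n - s) - 1/(D (n+m) - s),\]
  and telescoping along \<open>n, n+m, n+2*m, \<dots>\<close> places the inverse of the sum within \<open>s\<close> of \<open>D n\<close>.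
\<close>

lemma tribonacci_root_exists:
  obtains a :: real where "9/5 \<le> a" "a \<le> 2" "a^3 = a^2 + a + 1"
proof -
  have "\<exists>x\<ge>9/5. x \<le> 2 \<and> (\<lambda>x::real. x^3 - x^2 - x - 1) x = 0"
    by (rule IVT') (auto simp: power2_eq_square power3_eq_cube intro!: continuous_intros)
  then obtain x :: real where "9/5 \<le> x" "x \<le> 2" "x^3 - x^2 - x - 1 = 0"
    by auto
  then show ?thesis
    by (intro that[of x]) auto
qed

text \<open>A real substitute for diagonalising with complex roots: as \<open>p^2 < 4 * q\<close>,
  the quadratic form \<open>V\<close> is positive definite and bounds \<open>(u n)^2\<close> up to a
  constant, while \<open>q < 1\<close> makes it decay geometrically.\<close>

lemma binary_recurrence_tendsto_0:
  fixes u :: "nat \<Rightarrow> real"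
  assumes rec: "\<And>n. u (Suc (Suc n)) = - p * u (Suc n) - q * u n"
    and disc: "p^2 < 4 * q" and q: "q < 1"
  shows "u \<longlonglongrightarrow> 0"
proof -
  \<comment> \<open>The norm form of the recurrence: each step multiplies it by the product of the roots.\<close>
  define V where "V n = (u (Suc n))^2 + p * u n * u (Suc n) + q * (u n)^2" for n
  have "V (Suc n) = q * V n" for n
    unfolding V_def rec by algebra
  then have V: "V n = q^n * V 0" for n
    by (induction n) auto
  have "0 \<le> p^2" by simp
  with disc have "0 \<le> q" by linarith
  with q have "(\<lambda>n. q^n) \<longlonglongrightarrow> 0"
    by (intro LIMSEQ_realpow_zero)
  then have lim: "(\<lambda>n. q^n * V 0 / (q - p^2/4)) \<longlonglongrightarrow> 0"
    by (intro tendsto_divide_zero tendsto_mult_left_zero)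
  have "(q - p^2/4) * (u n)^2 \<le> V n" for n
  proof -
    have "V n - (q - p^2/4) * (u n)^2 = (u (Suc n) + p/2 * u n)^2"
      by (simp add: V_def power2_eq_square field_simps)
    moreover have "\<dots> \<ge> 0" by simp
    ultimately show ?thesis by linarith
  qed
  then have "(q - p^2/4) * (u n)^2 \<le> q^n * V 0" for n
    by (simp only: V[symmetric])
  then have "(u n)^2 \<le> q^n * V 0 / (q - p^2/4)" for n
    using disc by (simp add: pos_le_divide_eq mult.commute)
  then have "(\<lambda>n. (u n)^2) \<longlonglongrightarrow> 0"
    by (intro tendsto_sandwich[OF _ _ tendsto_const lim]) auto
  then have "(\<lambda>n. sqrt ((u n)^2)) \<longlonglongrightarrow> sqrt 0"
    by (rule tendsto_real_sqrt)
  then show ?thesis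
    by (simp add: tendsto_rabs_zero_iff)
qed

text \<open>The cubic factors as \<open>(x - a) * (x^2 + (a - 1) * x + q)\<close> with
  \<open>q = a^2 - a - 1 = 1 / a\<close>. Passing from \<open>T\<close> to \<open>u\<close> removes
  the root \<open>a\<close>, so the quadratic factor governs \<open>u\<close>.\<close>

lemma tribonacci_ratio_defect_tendsto_0:
  obtains a :: real where
    "\<And>m. (\<lambda>n. real (tribonacci (n + m)) - a^m * real (tribonacci n)) \<longlonglongrightarrow> 0"
proof -
  obtain a :: real where a: "9/5 \<le> a" "a \<le> 2" and root: "a^3 = a^2 + a + 1"
    by (rule tribonacci_root_exists)
  define q where "q = a^2 - a - 1"
  define u where "u n = real (tribonacci (Suc n)) - a * real (tribonacci n)" for n
  have aq: "a * q = 1"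
    using root by (simp add: q_def algebra_simps power2_eq_square power3_eq_cube)
  have q: "q = 1 / a"
    using aq a by (simp add: field_simps)
  \<comment> \<open>Discriminant condition:
    \<open>(a - 1)^2 \<le> 1 < 2 \<le> 4 * q\<close>.\<close>
  have "(a - 1)^2 \<le> 1^2"
    using a by (intro power_mono) auto
  moreover have "1/2 \<le> q" "q < 1"
    using a by (simp_all add: q field_simps)
  moreover have "u (Suc (Suc n)) = - (a - 1) * u (Suc n) - q * u n" for n
  proof -
    have "u (Suc (Suc n)) - (- (a - 1) * u (Suc n) - q * u n) =
        (1 - a * q) * real (tribonacci n)"
      by (simp add: u_def q_def algebra_simps power2_eq_square)
    then show ?thesis by (simp add: aq)
  qed
  ultimately have u: "u \<longlonglongrightarrow> 0"
    by (intro binary_recurrence_tendsto_0[where p = "a - 1" and q = q]) auto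
  have "(\<lambda>n. real (tribonacci (n + m)) - a^m * real (tribonacci n)) \<longlonglongrightarrow> 0" for m
  proof (induction m)
    case 0
    then show ?case by simp
  next
    case (Suc m)
    have "(\<lambda>n. u (n + m) + a * (real (tribonacci (n + m)) - a^m * real (tribonacci n))) \<longlonglongrightarrow> 0 + a * 0"
      by (intro tendsto_add tendsto_mult tendsto_const Suc LIMSEQ_ignore_initial_segment u)
    then show ?case
      by (simp add: u_def algebra_simps)
  qed
  then show ?thesis by (rule that)
qed

lemma tribonacci_mono: "m \<le> n \<Longrightarrow> tribonacci m \<le> tribonacci n"
proof (rule lift_Suc_mono_le[where f = tribonacci])
  show "tribonacci n \<le> tribonacci (Suc n)" for n
    by (cases n rule: tribonacci.cases) auto
qed

text \<open>Linear growth suffices to make the differences \<open>D n\<close> positive and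
  divergent. Equality holds at 2 and 3.\<close>

lemma tribonacci_ge: "n \<le> tribonacci n + 1"
proof (induction n rule: tribonacci.induct)
  case (4 n)
  have "n > 0 \<Longrightarrow> tribonacci 1 \<le> tribonacci n"
    by (intro tribonacci_mono) auto
  moreover have "tribonacci 1 \<le> tribonacci (Suc n)"
    by (intro tribonacci_mono) auto
  ultimately show ?case using 4 by (cases n) auto
qed auto

lemma tribonacci_gap: "0 < m \<Longrightarrow> m + 3 \<le> n \<Longrightarrow>
    tribonacci (n - m) + tribonacci (n - 2) \<le> tribonacci n"
proof -
  assume m: "0 < m" "m + 3 \<le> n"
  define k where "k = n - 3"
  have "n = Suc (Suc (Suc k))" using m by (simp add: k_def)
  moreover have "tribonacci (n - m) \<le> tribonacci (n - 1)"
    using m by (intro tribonacci_mono) auto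
  ultimately show ?thesis by simp
qed

lemma tribonacci_shifted_Cassini_bound:
  fixes \<epsilon> :: real
  assumes "0 < \<epsilon>"
  shows "\<forall>\<^sub>F n in sequentially.
    \<bar>real (tribonacci n) * real (tribonacci (n + 2 * m)) - (real (tribonacci (n + m)))^2\<bar>
      \<le> \<epsilon> * real (tribonacci (n + m))"
proof -
  obtain a :: real where
    lim: "\<And>m. (\<lambda>n. real (tribonacci (n + m)) - a^m * real (tribonacci n)) \<longlonglongrightarrow> 0"
    by (rule tribonacci_ratio_defect_tendsto_0) blast
  define w where "w n = real (tribonacci (n + m)) - a^m * real (tribonacci n)" for n
  have w: "w \<longlonglongrightarrow> 0"
    using lim[of m] by (simp add: w_def[abs_def])
  have "(\<lambda>n. \<bar>w (n + m)\<bar> + \<bar>w n\<bar>) \<longlonglongrightarrow> 0"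
    using tendsto_add[OF tendsto_rabs_zero[OF LIMSEQ_ignore_initial_segment[OF w, of m]] tendsto_rabs_zero[OF w]]
    by simp
  then have "\<forall>\<^sub>F n in sequentially. \<bar>w (n + m)\<bar> + \<bar>w n\<bar> < \<epsilon>"
    using assms by (rule order_tendstoD)
  then show ?thesis
  proof eventually_elim
    case (elim n)
    let ?T = "\<lambda>n. real (tribonacci n)"
    have "n + 2 * m = (n + m) + m" by simp
    \<comment> \<open>The two terms \<open>a^m * T n * T (n + m)\<close> cancel, leaving only
      products with a small factor \<open>w\<close>.\<close>
    then have "?T n * ?T (n + 2 * m) - (?T (n + m))^2 = ?T n * w (n + m) - ?T (n + m) * w n"
      by (simp only: w_def) (simp add: algebra_simps power2_eq_square)
    also have "\<bar>\<dots>\<bar> \<le> ?T n * \<bar>w (n + m)\<bar> + ?T (n + m) * \<bar>w n\<bar>"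
      by (rule order_trans[OF abs_triangle_ineq4]) (simp add: abs_mult)
    also have "\<dots> \<le> ?T (n + m) * \<bar>w (n + m)\<bar> + ?T (n + m) * \<bar>w n\<bar>"
      by (intro add_mono mult_right_mono) (auto intro: tribonacci_mono)
    also have "\<dots> = ?T (n + m) * (\<bar>w (n + m)\<bar> + \<bar>w n\<bar>)"
      by (simp add: algebra_simps)
    also have "\<dots> \<le> ?T (n + m) * \<epsilon>"
      using elim by (intro mult_left_mono) auto
    finally show ?case by (simp add: mult.commute)
  qed
qed

theorem theorem1p8:
  fixes m :: nat
  assumes "m > 0"
  shows "\<exists>N\<ge>m. \<forall>n\<ge>N.
    summable (\<lambda>k. 1 / real (tribonacci (n + m * k))) \<and>
    round (inverse (\<Sum>k. 1 / real (tribonacci (n + m * k)))) =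
      int (tribonacci n) - int (tribonacci (n - m))"
proof -
  define T where "T n = real (tribonacci n)" for n
  define D where "D n = T n - T (n - m)" for n
  \<comment> \<open>The constant 1/8 is half of \<open>s = 1/4\<close>, which leaves a margin
    \<open>T n / 8\<close> for the term \<open>s^2\<close>.\<close>
  obtain N0 where N0: "\<bar>T n * T (n + 2 * m) - (T (n + m))^2\<bar> \<le> 1/8 * T (n + m)" if "n \<ge> N0" for n
    using tribonacci_shifted_Cassini_bound[of "1/8" m]
    by (auto simp: eventually_sequentially T_def)
  \<comment> \<open>\<open>N0 + m\<close> permits using the bound at \<open>n - m\<close>; the 4
    turns \<open>n - 3 \<le> D n\<close> into \<open>1 \<le> D n\<close>.\<close>
  define N where "N = N0 + m + 4"
  have T_ge: "real n - 1 \<le> T n" for n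
    using tribonacci_ge[of n] by (simp add: T_def)
  have D_ge: "T (n - 2) \<le> D n" if "n \<ge> N" for n
    using tribonacci_gap[of m n] that assms by (simp add: T_def D_def N_def)
  have D_ge': "real n - 3 \<le> D n" if "n \<ge> N" for n
    using D_ge[OF that] T_ge[of "n - 2"] that by (simp add: N_def of_nat_diff)
  have D_pos: "1 \<le> D n" if "n \<ge> N" for n
    using D_ge'[OF that] that by (simp add: N_def)
  have step: "1 / (D n + 1/4) - 1 / (D (n + m) + 1/4) \<le> 1 / T n"
    "1 / T n \<le> 1 / (D n - 1/4) - 1 / (D (n + m) - 1/4)" if n: "n \<ge> N" for n
  proof -
    have T1: "1 \<le> T n"
      using T_ge[of n] n by (simp add: N_def)
    have D1: "1 \<le> D n" "1 \<le> D (n + m)"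
      using D_pos n by auto
    define X where "X = T (n - m) * T (n + m) - (T n)^2"
    have "\<bar>X\<bar> \<le> 1/8 * T n"
      using N0[of "n - m"] n by (simp add: X_def N_def mult_2)
    then have X: "X \<le> T n / 8" "- X \<le> T n / 8"
      by (simp_all add: abs_le_iff)
    \<comment> \<open>The sum collapses to \<open>T (n + m) - T (n - m)\<close>, and
      \<open>n - m \<le> n + m - 2\<close> because \<open>m \<ge> 1\<close>.\<close>
    have sum_ge: "T n \<le> D n + D (n + m)"
    proof -
      have "tribonacci (n - m) \<le> tribonacci (n + m - 2)"
        using assms n by (intro tribonacci_mono) auto
      then have "T n \<le> T (n + m) - T (n - m)"
        using tribonacci_gap[of m "n + m"] assms n by (simp add: T_def N_def)
      then show ?thesis by (simp add: D_def)
    qed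
    have ident: "T n * (D (n + m) - D n) - (D n + s) * (D (n + m) + s) =
        X - s * (D n + D (n + m)) - s^2" for s
      by (simp add: D_def X_def algebra_simps power2_eq_square)
    have diff: "1 / (D n + s) - 1 / (D (n + m) + s) - 1 / T n =
        (X - s * (D n + D (n + m)) - s^2) / ((D n + s) * (D (n + m) + s) * T n)"
      if "-1 < s" for s
    proof -
      have "1 / A - 1 / B - 1 / t = (t * (B - A) - A * B) / (A * B * t)"
        if "A \<noteq> 0" "B \<noteq> 0" "t \<noteq> 0" for A B t :: real
        using that by (simp add: field_simps)
      from this[of "D n + s" "D (n + m) + s" "T n"] show ?thesis
        using that D1 T1 by (simp add: ident[symmetric])
    qed
    have "X - 1/4 * (D n + D (n + m)) - (1/4)^2 \<le> 0"
      using X sum_ge T1 by (simp add: power2_eq_square field_simps)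
    then have "1 / (D n + 1/4) - 1 / (D (n + m) + 1/4) - 1 / T n \<le> 0"
      using D1 T1 by (subst diff) (auto intro!: divide_nonpos_nonneg)
    then show "1 / (D n + 1/4) - 1 / (D (n + m) + 1/4) \<le> 1 / T n" by simp
    \<comment> \<open>Here \<open>s^2 = 1/16\<close> works against the inequality;
      \<open>T n / 4 - T n / 8\<close> absorbs it since \<open>T n \<ge> 1\<close>.\<close>
    have "X - (-1/4) * (D n + D (n + m)) - (-1/4)^2 \<ge> 0"
      using X sum_ge T1 by (simp add: power2_eq_square field_simps)
    then have "1 / (D n + (-1/4)) - 1 / (D (n + m) + (-1/4)) - 1 / T n \<ge> 0"
      using D1 T1 by (subst diff) (auto intro!: divide_nonneg_nonneg)
    then show "1 / T n \<le> 1 / (D n - 1/4) - 1 / (D (n + m) - 1/4)" by simp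
  qed
  have "summable (\<lambda>k. 1 / T (n + m * k)) \<and> round (inverse (\<Sum>k. 1 / T (n + m * k))) =
      int (tribonacci n) - int (tribonacci (n - m))" if n: "n \<ge> N" for n
  proof -
    have D_lim: "filterlim (\<lambda>k. D (n + m * k)) at_top sequentially"
    proof (rule filterlim_at_top_mono[OF filterlim_real_sequentially], rule always_eventually, rule allI)
      fix k
      have "k \<le> m * k" using assms by simp
      then have "n + k \<le> n + m * k" by simp
      moreover have "4 \<le> n" using n by (simp add: N_def)
      ultimately show "real k \<le> D (n + m * k)"
        using D_ge'[of "n + m * k"] n by linarith
    qed
    \<comment> \<open>Only the limit 0 of the reciprocals matters, so no sign condition on
      \<open>s\<close> is imposed.\<close>
    have tele: "(\<lambda>k. 1 / (D (n + m * k) + s) - 1 / (D (n + m * k + m) + s)) sums (1 / (D n + s))" for s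
    proof -
      have "filterlim (\<lambda>k. s + D (n + m * k)) at_top sequentially"
        by (intro filterlim_tendsto_add_at_top[OF tendsto_const] D_lim)
      then have "(\<lambda>k. 1 / (D (n + m * k) + s)) \<longlonglongrightarrow> 0"
        by (intro tendsto_divide_0[OF tendsto_const] filterlim_at_top_imp_at_infinity)
          (simp add: add.commute)
      from telescope_sums'[OF this] show ?thesis
        by (simp add: algebra_simps)
    qed
    note lower = tele[of "1/4"] and upper = tele[of "-1/4", simplified]
    have T_nonneg: "0 \<le> 1 / T k" for k by (simp add: T_def)
    have summ: "summable (\<lambda>k. 1 / T (n + m * k))"
      \<comment> \<open>The upper telescoping series is a convergent majorant.\<close>
      by (rule summable_comparison_test_ev[OF _ sums_summable[OF upper]])
        (use step(2) n T_nonneg in auto)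
    define S where "S = (\<Sum>k. 1 / T (n + m * k))"
    have S: "(\<lambda>k. 1 / T (n + m * k)) sums S"
      using summ by (simp add: S_def summable_sums)
    have S_ge: "1 / (D n + 1/4) \<le> S"
      by (rule sums_le[OF _ lower S]) (use step(1) n in auto)
    have S_le: "S \<le> 1 / (D n - 1/4)"
      by (rule sums_le[OF _ S upper]) (use step(2) n in auto)
    have D1: "1 \<le> D n" using D_pos n by auto
    then have "0 < 1 / (D n + 1/4)" by simp
    with S_ge have "0 < S" by linarith
    then have "inverse S \<le> D n + 1/4" "D n - 1/4 \<le> inverse S"
      using S_ge S_le D1 by (simp_all add: field_simps)
    moreover have "D n = real_of_int (int (tribonacci n) - int (tribonacci (n - m)))"
      by (simp add: D_def T_def)
    ultimately have "round (inverse S) = int (tribonacci n) - int (tribonacci (n - m))"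
      \<comment> \<open>The distance is at most 1/4, below the 1/2 that determines the
        rounding.\<close>
      by (intro round_unique') linarith
    with summ show ?thesis by (simp add: S_def)
  qed
  moreover have "N \<ge> m" by (simp add: N_def)
  ultimately show ?thesis unfolding T_def by blast
qed

end
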